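(* Let $(X,\leq)$ be a bounded lattice, with least element $\bot$ and greatest element $\top$, which is moreover a well-order. Let $\mathrm{NS}(X)$ be the set of subsets $Y\subseteq X$ such that both $N(Y)$ and $N(X\setminus Y)$ are defined and are finite regions, ordered by inclusion. Then $\mathrm{NS}(X)$ is a boolean algebra if and only if $X$ is finitely complemented.
   Context: A poset is a well-order when every infinite sequence $(x_i)_{i\in\mathbb N}$ has indices $i<j$ with $x_i\leq x_j$. An interval of $X$ is a pair $(x,y)$ with $x\leq y$; its support is $[x,y]=\{z\in X : x\leq z\leq y\}$, and for intervals $I,J$ we write $I\subseteq J$ for inclusion of supports. A region is a set of intervals; it is finite if it has finitely many intervals; its support is $[R]=\bigcup_{I\in R}[I]$. For regions $R,S$, write $R\preceq S$ iff for every $I\in R$ there is $J\in S$ with $I\subseteq J$, and $R\leq S$ iff $R\preceq S$ and ($S\preceq R$ implies $S\subseteq R$ as sets of intervals); $\leq$ is a partial order on regions. For $Y\subseteq X$, $N(Y)$ denotes the supremum, with respect to $\leq$, of the set of regions $R$ with $[R]\subseteq Y$, when this supremum exists (otherwise $N(Y)$ is undefined). For $Y\subseteq X$: the lower closure is $\downarrow Y=\{x: \exists y\in Y,\ x\leq y\}$, the upper closure $\uparrow Y$ is dual; the lower complement is $Y^{\downarrow c}=\{x\in X:\forall y\in Y,\ x\not\geq y\}$ and the upper complement is $Y^{\uparrow c}=\{x\in X:\forall y\in Y,\ x\not\leq y\}$. $Y$ is finitely lower (resp. upper) generated if $Y=\downarrow Y'$ (resp. $Y=\uparrow Y'$) for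 some finite $Y'$. $Y$ is finitely lower complemented if $Y^{\downarrow c}$ is finitely lower generated, and finitely upper complemented if $Y^{\uparrow c}$ is finitely upper generated; an element $x$ is finitely lower/upper complemented when $\{x\}$ is. $\max Y$ and $\min Y$ are the sets of maximal and minimal elements of $Y$. The poset $X$ is finitely complemented if (i) for every finitely lower complemented $x\in X$, every element of $\max(\{x\}^{\downarrow c})$ is finitely upper complemented, and (ii) for every finitely upper complemented $x\in X$, every element of $\min(\{x\}^{\uparrow c})$ is finitely lower complemented. *)

theory Defs
  imports "HOL-Algebra.Lattice"
begin

text \<open>
  A poset \<open>X\<close> is rendered as a type of class \<^class>\<open>order\<close>; properties of \<open>X\<close> itself
  take an \<open>itself\<close> argument naming that type.
\<close>

text \<open>The ``well-order'' condition is not the totally ordered notion of the library.\<close>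

definition well_order_poset :: "'a::order itself \<Rightarrow> bool" where
  "well_order_poset _ \<longleftrightarrow> (\<forall>x :: nat \<Rightarrow> 'a. \<exists>i j. i < j \<and> x i \<le> x j)"

definition supp :: "'a::order \<times> 'a \<Rightarrow> 'a set" where
  "supp I = {fst I..snd I}"

definition regions :: "('a::order \<times> 'a) set set" where
  "regions = {R. \<forall>(x, y) \<in> R. x \<le> y}"

definition region_supp :: "('a::order \<times> 'a) set \<Rightarrow> 'a set" where
  "region_supp R = (\<Union>I\<in>R. supp I)"

definition region_preceq :: "('a::order \<times> 'a) set \<Rightarrow> ('a \<times> 'a) set \<Rightarrow> bool" where
  "region_preceq R S \<longleftrightarrow> (\<forall>I\<in>R. \<exists>J\<in>S. supp I \<subseteq> supp J)"

definition region_le :: "('a::order \<times> 'a) set \<Rightarrow> ('a \<times> 'a) set \<Rightarrow> bool" where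
  "region_le R S \<longleftrightarrow> region_preceq R S \<and> (region_preceq S R \<longrightarrow> S \<subseteq> R)"

definition region_poset :: "('a::order \<times> 'a) set gorder" where
  "region_poset = \<lparr>carrier = regions, eq = (=), le = region_le\<rparr>"

lemma region_preceq_trans:
  "region_preceq R S \<Longrightarrow> region_preceq S T \<Longrightarrow> region_preceq R T"
  unfolding region_preceq_def by (meson subset_trans)

lemma region_poset_partial_order: "partial_order region_poset"
proof unfold_locales
  fix R S T :: "('a::order \<times> 'a) set"
  assume "R \<sqsubseteq>\<^bsub>region_poset\<^esub> S" "S \<sqsubseteq>\<^bsub>region_poset\<^esub> T"
  then have *: "region_preceq R S" "region_preceq S R \<longrightarrow> S \<subseteq> R"
      "region_preceq S T" "region_preceq T S \<longrightarrow> T \<subseteq> S"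
    by (auto simp: region_poset_def region_le_def)
  then show "R \<sqsubseteq>\<^bsub>region_poset\<^esub> T"
    using region_preceq_trans[of R S T] region_preceq_trans[of T R S] region_preceq_trans[of S T R]
    by (auto simp: region_poset_def region_le_def)
qed (auto simp: region_poset_def region_le_def region_preceq_def)

text \<open>
  The partial function \<open>N\<close> is given by its graph: \<open>is_N Y R\<close> says that \<open>N(Y)\<close> is defined
  and equals \<open>R\<close>. The supremum is taken in the poset of all regions, so \<open>R\<close> is not
  required a priori to have its support inside \<open>Y\<close>; it is unique by antisymmetry.
\<close>

definition is_N :: "'a::order set \<Rightarrow> ('a \<times> 'a) set \<Rightarrow> bool" where
  "is_N Y R \<longleftrightarrow> is_lub region_poset R {S \<in> regions. region_supp S \<subseteq> Y}"

definition NS :: "'a::order set set" where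
  "NS = {Y. (\<exists>R. is_N Y R \<and> finite R) \<and> (\<exists>R. is_N (- Y) R \<and> finite R)}"

definition lower_closure :: "'a::order set \<Rightarrow> 'a set" where
  "lower_closure Y = {x. \<exists>y\<in>Y. x \<le> y}"

definition upper_closure :: "'a::order set \<Rightarrow> 'a set" where
  "upper_closure Y = {x. \<exists>y\<in>Y. y \<le> x}"

definition lower_complement :: "'a::order set \<Rightarrow> 'a set" where
  "lower_complement Y = {x. \<forall>y\<in>Y. \<not> y \<le> x}"

definition upper_complement :: "'a::order set \<Rightarrow> 'a set" where
  "upper_complement Y = {x. \<forall>y\<in>Y. \<not> x \<le> y}"

definition finitely_lower_generated :: "'a::order set \<Rightarrow> bool" where
  "finitely_lower_generated Y \<longleftrightarrow> (\<exists>Y'. finite Y' \<and> Y = lower_closure Y')"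

definition finitely_upper_generated :: "'a::order set \<Rightarrow> bool" where
  "finitely_upper_generated Y \<longleftrightarrow> (\<exists>Y'. finite Y' \<and> Y = upper_closure Y')"

definition finitely_lower_complemented :: "'a::order set \<Rightarrow> bool" where
  "finitely_lower_complemented Y \<longleftrightarrow> finitely_lower_generated (lower_complement Y)"

definition finitely_upper_complemented :: "'a::order set \<Rightarrow> bool" where
  "finitely_upper_complemented Y \<longleftrightarrow> finitely_upper_generated (upper_complement Y)"

definition max_elems :: "'a::order set \<Rightarrow> 'a set" where
  "max_elems Y = {y \<in> Y. \<forall>z\<in>Y. y \<le> z \<longrightarrow> z = y}"

definition min_elems :: "'a::order set \<Rightarrow> 'a set" where
  "min_elems Y = {y \<in> Y. \<forall>z\<in>Y. z \<le> y \<longrightarrow> z = y}"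

definition finitely_complemented :: "'a::order itself \<Rightarrow> bool" where
  "finitely_complemented _ \<longleftrightarrow>
     (\<forall>x::'a. finitely_lower_complemented {x} \<longrightarrow>
        (\<forall>y \<in> max_elems (lower_complement {x}). finitely_upper_complemented {y})) \<and>
     (\<forall>x::'a. finitely_upper_complemented {x} \<longrightarrow>
        (\<forall>y \<in> min_elems (upper_complement {x}). finitely_lower_complemented {y}))"

text \<open>
  A boolean algebra as an ordered structure: a bounded, distributive and complemented lattice.
  For a family of sets ordered by inclusion, the lattice operations are those of the family as
  a poset; they are not assumed to be union and intersection.
\<close>

definition boolean_algebra_order :: "'b gorder \<Rightarrow> bool" where
  "boolean_algebra_order L \<longleftrightarrow>
     bounded_lattice L \<and>
     (\<forall>x\<in>carrier L. \<forall>y\<in>carrier L. \<forall>z\<in>carrier L.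
        x \<sqinter>\<^bsub>L\<^esub> (y \<squnion>\<^bsub>L\<^esub> z) = (x \<sqinter>\<^bsub>L\<^esub> y) \<squnion>\<^bsub>L\<^esub> (x \<sqinter>\<^bsub>L\<^esub> z)) \<and>
     (\<forall>x\<in>carrier L. \<exists>y\<in>carrier L. x \<sqinter>\<^bsub>L\<^esub> y = \<bottom>\<^bsub>L\<^esub> \<and> x \<squnion>\<^bsub>L\<^esub> y = \<top>\<^bsub>L\<^esub>)"

definition inclusion_poset :: "'b set set \<Rightarrow> 'b set gorder" where
  "inclusion_poset F = \<lparr>carrier = F, eq = (=), le = (\<subseteq>)\<rparr>"

end

theory Submission
  imports Defs
begin

text \<open>
  Call a set \<open>Y\<close> interval-compact if finitely many intervals inside \<open>Y\<close> absorb every interval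
  inside \<open>Y\<close>. A finite region is \<open>N(Y)\<close> precisely when it consists of the maximal intervals
  of an interval-compact \<open>Y\<close>, so \<open>NS\<close> consists of the sets that are interval-compact
  together with their complement; such sets are closed under complement, and everything hinges on
  their intersections.

  By the well-order property every upper set is finitely generated, so every element is finitely
  upper complemented and \<open>NS\<close> contains all principal down-sets.
  If \<open>X\<close> is finitely complemented, each interval inside some \<open>Y \<in> NS\<close> extends downwards, inside
  \<open>Y\<close>, to one whose lower end is finitely lower complemented. The complement of such an interval
  is interval-compact, whence \<open>NS\<close> is closed under intersection.
  Conversely, if \<open>NS\<close> is a boolean algebra and \<open>m\<close> is minimal among the elements not below
  \<open>x\<close>, then \<open>{..m} - {..x} = {m}\<close>; distributivity forces the meet of \<open>{..m}\<close> and \<open>- {..x}\<close> to be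
  nonempty, so \<open>{m} \<in> NS\<close>, and the intervals of \<open>- {m}\<close> starting at the bottom element show
  that \<open>m\<close> is finitely lower complemented.
\<close>

section \<open>Finite suprema of regions\<close>

text \<open>\<open>R\<close> need not be a region: a pair whose ends are out of order stands for the
  empty set. End points may thus be replaced by joins and meets without a case split.\<close>

definition interval_compact :: "'a::order set \<Rightarrow> bool" where
  "interval_compact Y \<longleftrightarrow>
     (\<exists>R. finite R \<and> (\<forall>a b. (a, b) \<in> R \<longrightarrow> {a..b} \<subseteq> Y) \<and>
          (\<forall>x y. x \<le> y \<longrightarrow> {x..y} \<subseteq> Y \<longrightarrow> (\<exists>a b. (a, b) \<in> R \<and> a \<le> x \<and> y \<le> b)))"

lemma interval_compactI:
  assumes "finite R"
    and "\<And>a b. (a, b) \<in> R \<Longrightarrow> {a..b} \<subseteq> Y"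
    and "\<And>x y. x \<le> y \<Longrightarrow> {x..y} \<subseteq> Y \<Longrightarrow> \<exists>(a, b)\<in>R. a \<le> x \<and> y \<le> b"
  shows "interval_compact Y"
  unfolding interval_compact_def
proof (intro exI[of _ R] conjI allI impI)
  fix x y assume "x \<le> y" "{x..y} \<subseteq> Y"
  then obtain a b where "(a, b) \<in> R" "a \<le> x \<and> y \<le> b"
    using assms(3) by blast
  then show "\<exists>a b. (a, b) \<in> R \<and> a \<le> x \<and> y \<le> b"
    by blast
qed (use assms(1,2) in auto)

lemma interval_compactE:
  assumes "interval_compact Y"
  obtains R where "finite R"
    and "\<forall>a b. (a, b) \<in> R \<longrightarrow> {a..b} \<subseteq> Y"
    and "\<forall>x y. x \<le> y \<longrightarrow> {x..y} \<subseteq> Y \<longrightarrow> (\<exists>a b. (a, b) \<in> R \<and> a \<le> x \<and> y \<le> b)"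
  using assms unfolding interval_compact_def by (elim exE conjE)

lemma is_N_iff:
  "is_N Y R \<longleftrightarrow> R \<in> regions \<and>
     (\<forall>S\<in>regions. region_supp S \<subseteq> Y \<longrightarrow> region_le S R) \<and>
     (\<forall>T\<in>regions. (\<forall>S\<in>regions. region_supp S \<subseteq> Y \<longrightarrow> region_le S T) \<longrightarrow> region_le R T)"
  unfolding is_N_def least_def Upper_def region_poset_def by auto

lemma region_subset_intervals:
  assumes "S \<in> regions" "region_supp S \<subseteq> Y"
  shows "S \<subseteq> {(x, y). x \<le> y \<and> {x..y} \<subseteq> Y}"
proof
  fix I assume "I \<in> S"
  then have "supp I \<subseteq> Y" "fst I \<le> snd I"
    using assms by (auto simp: regions_def region_supp_def)
  then show "I \<in> {(x, y). x \<le> y \<and> {x..y} \<subseteq> Y}"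
    by (simp add: supp_def case_prod_unfold)
qed

text \<open>The region \<open>F\<close> of all intervals inside \<open>Y\<close> lies below
  \<open>R\<close>, so \<open>R\<close> absorbs them all. If \<open>R\<close> stays inside
  \<open>Y\<close> it is the witness; otherwise \<open>F\<close> itself is finite.\<close>

lemma interval_compact_if_is_N:
  assumes N: "is_N Y R" and fin: "finite R"
  shows "interval_compact Y"
proof -
  define F where "F = {(x, y). x \<le> y \<and> {x..y} \<subseteq> Y}"
  have F: "F \<in> regions" "region_supp F \<subseteq> Y"
    by (auto simp: F_def regions_def region_supp_def supp_def)
  have R: "R \<in> regions" and FR: "region_le F R"
    using N F by (auto simp: is_N_iff)
  have cov: "\<exists>(a, b)\<in>G. a \<le> x \<and> y \<le> b" if G: "region_preceq F G" and xy: "x \<le> y" "{x..y} \<subseteq> Y" for G x y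
  proof -
    have "(x, y) \<in> F"
      using xy by (simp add: F_def)
    then obtain J where "J \<in> G" "{x..y} \<subseteq> {fst J..snd J}"
      using G by (force simp: region_preceq_def supp_def)
    then show ?thesis
      using xy(1) by (intro bexI[of _ J]) auto
  qed
  show ?thesis
  proof (cases "region_supp R \<subseteq> Y")
    case True
    show ?thesis
    proof (rule interval_compactI[OF fin])
      show "{a..b} \<subseteq> Y" if "(a, b) \<in> R" for a b
        using that True by (force simp: region_supp_def supp_def)
    qed (use cov FR in \<open>auto simp: region_le_def\<close>)
  next
    case False
    \<comment> \<open>The supremum may leave \<open>Y\<close>, but then it contains every interval of \<open>Y\<close>: compare it with
      the upper bound obtained by adding a single point outside \<open>Y\<close> to them.\<close>
    then obtain I z where I: "I \<in> R" "z \<in> supp I" "z \<notin> Y"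
      by (auto simp: region_supp_def)
    let ?U = "insert (z, z) F"
    have U: "?U \<in> regions"
      using F by (auto simp: regions_def)
    have "region_le S ?U" if S: "S \<in> regions" "region_supp S \<subseteq> Y" for S
    proof -
      have "S \<subseteq> F"
        using S region_subset_intervals unfolding F_def by blast
      moreover have "\<not> region_preceq ?U S"
      proof
        assume "region_preceq ?U S"
        then obtain J where "J \<in> S" "supp (z, z) \<subseteq> supp J"
          unfolding region_preceq_def by blast
        then have "z \<in> region_supp S"
          by (auto simp: region_supp_def supp_def)
        then show False
          using S I by blast
      qed
      ultimately show ?thesis
        by (auto simp: region_le_def region_preceq_def)
    qed
    then have "region_le R ?U"
      using N U by (auto simp: is_N_iff)
    \<comment> \<open>An interval of \<open>R\<close> contains \<open>z\<close>, so \<open>R\<close>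
      absorbs \<open>?U\<close>; the second half of \<open>region_le R ?U\<close> then turns this
      into inclusion of sets.\<close>
    moreover have "region_preceq ?U R"
      using FR I by (auto simp: region_le_def region_preceq_def supp_def intro!: bexI[of _ I])
    ultimately have "F \<subseteq> R"
      by (auto simp: region_le_def)
    then have "finite F"
      using fin finite_subset by blast
    then show ?thesis
      by (rule interval_compactI) (auto simp: F_def)
  qed
qed

text \<open>The maximal intervals inside \<open>Y\<close> form a region \<open>T\<close>. Each is
  absorbed by, hence equal to, a member of \<open>R\<close>, so \<open>T\<close> is finite; it is
  the greatest region inside \<open>Y\<close> and therefore the supremum.\<close>

lemma is_N_if_interval_compact:
  assumes "interval_compact Y"
  shows "\<exists>R. is_N Y R \<and> finite R"
proof -
  obtain R where R: "finite R" "\<forall>a b. (a, b) \<in> R \<longrightarrow> {a..b} \<subseteq> Y"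
    "\<forall>x y. x \<le> y \<longrightarrow> {x..y} \<subseteq> Y \<longrightarrow> (\<exists>a b. (a, b) \<in> R \<and> a \<le> x \<and> y \<le> b)"
    using assms by (rule interval_compactE)
  note fin = R(1) and RY = R(2)[rule_format] and cov = R(3)[rule_format]
  define F where "F = {(x, y). x \<le> y \<and> {x..y} \<subseteq> Y}"
  define T where "T = {I \<in> F. \<forall>J\<in>F. supp I \<subseteq> supp J \<longrightarrow> J = I}"
  have FR: "\<exists>J\<in>R \<inter> F. supp I \<subseteq> supp J" if IF: "I \<in> F" for I
  proof -
    obtain x y where I: "I = (x, y)" "x \<le> y" "{x..y} \<subseteq> Y"
      using IF by (auto simp: F_def)
    then obtain a b where ab: "(a, b) \<in> R" "a \<le> x" "y \<le> b"
      using cov by blast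
    then have "(a, b) \<in> F"
      using I RY[OF ab(1)] by (auto simp: F_def)
    then show ?thesis
      using ab I by (intro bexI[of _ "(a, b)"]) (auto simp: supp_def)
  qed
  have eqI: "I = J" if "I \<in> F" "J \<in> F" "supp I = supp J" for I J
    using that by (force simp: F_def supp_def)
  have "T \<subseteq> R"
    using FR by (fastforce simp: T_def)
  then have finT: "finite T"
    using fin finite_subset by blast
  have FT: "\<exists>J\<in>T. supp I \<subseteq> supp J" if "I \<in> F" for I
  proof -
    \<comment> \<open>A support maximal among these finitely many is maximal in all of
      \<open>F\<close>, since every interval of \<open>F\<close> is absorbed by one in
      \<open>R\<close>.\<close>
    let ?K = "supp ` {J \<in> R \<inter> F. supp I \<subseteq> supp J}"
    have "finite ?K" "?K \<noteq> {}"
      using fin FR[OF that] by auto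
    then obtain K where K: "K \<in> ?K" "\<forall>L\<in>?K. K \<subseteq> L \<longrightarrow> K = L"
      using finite_has_maximal by (metis (no_types, lifting))
    then obtain J where J: "J \<in> R \<inter> F" "supp I \<subseteq> supp J" "K = supp J"
      by auto
    have "J' = J" if J': "J' \<in> F" "supp J \<subseteq> supp J'" for J'
    proof -
      obtain J2 where J2: "J2 \<in> R \<inter> F" "supp J' \<subseteq> supp J2"
        using FR[OF J'(1)] by blast
      then have "supp J2 \<in> ?K"
        using J J' by auto
      moreover have "K \<subseteq> supp J2"
        unfolding J(3) using J2(2) J'(2) by (rule order_trans[rotated])
      ultimately have "K = supp J2"
        using K(2) by blast
      then have "supp J' = supp J"
        using J2(2) J'(2) J(3) by simp
      then show ?thesis
        using eqI[OF J'(1)] J(1) by blast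
    qed
    then have "J \<in> T"
      using J unfolding T_def by blast
    then show ?thesis
      using J by blast
  qed
  have "F \<in> regions" "region_supp F \<subseteq> Y"
    by (auto simp: F_def regions_def region_supp_def supp_def)
  moreover have "T \<subseteq> F"
    unfolding T_def by blast
  ultimately have T: "T \<in> regions" "region_supp T \<subseteq> Y"
    unfolding regions_def region_supp_def by blast+
  have "region_le S T" if S: "S \<in> regions" "region_supp S \<subseteq> Y" for S
  proof -
    have SF: "S \<subseteq> F"
      using S region_subset_intervals unfolding F_def by blast
    then have "region_preceq S T"
      using FT unfolding region_preceq_def by blast
    moreover have "T \<subseteq> S" if TS: "region_preceq T S"
    proof
      fix I assume I: "I \<in> T"
      then obtain J where "J \<in> S" "supp I \<subseteq> supp J"
        using TS unfolding region_preceq_def by blast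
      then show "I \<in> S"
        using I SF unfolding T_def by blast
    qed
    ultimately show ?thesis
      unfolding region_le_def by blast
  qed
  then have "is_N Y T"
    unfolding is_N_iff using T by blast
  then show ?thesis
    using finT by blast
qed

lemma NS_iff: "(Y :: 'a::order set) \<in> NS \<longleftrightarrow> interval_compact Y \<and> interval_compact (- Y)"
proof -
  have "(\<exists>R. is_N Z R \<and> finite R) \<longleftrightarrow> interval_compact Z" for Z :: "'a set"
    using interval_compact_if_is_N is_N_if_interval_compact by metis
  then show ?thesis
    by (simp add: NS_def)
qed

section \<open>Finite intersections of interval-compact sets\<close>

text \<open>Two intervals of a lattice intersect in the interval from the join of the lower ends to
  the meet of the upper ends, possibly empty.\<close>

lemma interval_compact_Int:
  fixes Y Z :: "'a::lattice set"
  assumes "interval_compact Y" "interval_compact Z"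
  shows "interval_compact (Y \<inter> Z)"
proof -
  obtain R where R: "finite R" "\<forall>a b. (a, b) \<in> R \<longrightarrow> {a..b} \<subseteq> Y"
    "\<forall>x y. x \<le> y \<longrightarrow> {x..y} \<subseteq> Y \<longrightarrow> (\<exists>a b. (a, b) \<in> R \<and> a \<le> x \<and> y \<le> b)"
    using assms(1) by (rule interval_compactE)
  note R = R[rule_format]
  obtain S where S: "finite S" "\<forall>a b. (a, b) \<in> S \<longrightarrow> {a..b} \<subseteq> Z"
    "\<forall>x y. x \<le> y \<longrightarrow> {x..y} \<subseteq> Z \<longrightarrow> (\<exists>a b. (a, b) \<in> S \<and> a \<le> x \<and> y \<le> b)"
    using assms(2) by (rule interval_compactE)
  note S = S[rule_format]
  let ?T = "(\<lambda>((a, b), (c, d)). (sup_class.sup a c, inf_class.inf b d)) ` (R \<times> S)"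
  show ?thesis
  proof (rule interval_compactI[of ?T])
    show "finite ?T"
      using R(1) S(1) by simp
    show "{a..b} \<subseteq> Y \<inter> Z" if T: "(a, b) \<in> ?T" for a b
    proof -
      obtain a1 b1 a2 b2 where "(a1, b1) \<in> R" "(a2, b2) \<in> S"
        and ab: "a = sup_class.sup a1 a2" "b = inf_class.inf b1 b2"
        using T by auto
      then have "{a1..b1} \<subseteq> Y" "{a2..b2} \<subseteq> Z"
        using R(2) S(2) by blast+
      moreover have "{a..b} \<subseteq> {a1..b1} \<inter> {a2..b2}"
        unfolding ab by auto
      ultimately show ?thesis
        by blast
    qed
    fix x y :: 'a
    assume xy: "x \<le> y" "{x..y} \<subseteq> Y \<inter> Z"
    obtain a b where ab: "(a, b) \<in> R" "a \<le> x" "y \<le> b"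
      using R(3)[OF xy(1)] xy(2) by auto
    obtain c d where cd: "(c, d) \<in> S" "c \<le> x" "y \<le> d"
      using S(3)[OF xy(1)] xy(2) by auto
    have "(sup_class.sup a c, inf_class.inf b d) \<in> ?T"
      using ab(1) cd(1) by (intro image_eqI[of _ _ "((a, b), (c, d))"]) simp_all
    moreover have "sup_class.sup a c \<le> x" "y \<le> inf_class.inf b d"
      using ab cd by simp_all
    ultimately show "\<exists>(a, b)\<in>?T. a \<le> x \<and> y \<le> b"
      by blast
  qed
qed

lemma interval_compact_UNIV: "interval_compact (UNIV :: 'a::bounded_lattice set)"
  by (rule interval_compactI[of "{(bot, top_class.top)}"]) auto

lemma interval_compact_empty: "interval_compact {}"
  by (rule interval_compactI[of "{}"]) auto

lemma interval_compact_INT: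
  fixes Y :: "'i \<Rightarrow> 'a::bounded_lattice set"
  assumes "finite I" "\<And>i. i \<in> I \<Longrightarrow> interval_compact (Y i)"
  shows "interval_compact (\<Inter>i\<in>I. Y i)"
  using assms by (induction) (auto simp: interval_compact_UNIV interval_compact_Int)

section \<open>Well-orders and finite complementation\<close>

text \<open>Otherwise one can keep choosing elements of \<open>U\<close> above none of those chosen
  before; \<open>L n\<close> collects the first \<open>n\<close> choices, and the resulting sequence
  contradicts the well-order property.\<close>

lemma well_order_finite_basis:
  assumes "well_order_poset TYPE('a::order)"
  shows "\<exists>F\<subseteq>U. finite F \<and> (\<forall>u\<in>U. \<exists>f\<in>F. f \<le> (u :: 'a))"
proof (rule ccontr)
  assume no_basis: "\<not> ?thesis"
  have "\<exists>u. u \<in> U \<and> (\<forall>f\<in>F. \<not> f \<le> u)" if "finite F" "F \<subseteq> U" for F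
    using no_basis that by simp metis
  then have "\<forall>F\<in>{F. finite F \<and> F \<subseteq> U}. \<exists>u. u \<in> U \<and> (\<forall>f\<in>F. \<not> f \<le> u)"
    by simp
  then obtain g where g: "\<And>F. finite F \<Longrightarrow> F \<subseteq> U \<Longrightarrow> g F \<in> U \<and> (\<forall>f\<in>F. \<not> f \<le> g F)"
    unfolding bchoice_iff by auto
  define L where "L = rec_nat {} (\<lambda>_ F. insert (g F) F)"
  have L: "L 0 = {}" "\<And>n. L (Suc n) = insert (g (L n)) (L n)"
    by (auto simp: L_def)
  have LU: "finite (L n) \<and> L n \<subseteq> U" for n
    by (induction n) (use g in \<open>auto simp: L\<close>)
  have "g (L i) \<in> L j" if "i < j" for i j
    using that by (induction j) (auto simp: L less_Suc_eq)
  then have "\<not> g (L i) \<le> g (L j)" if "i < j" for i j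
    using that g[of "L j"] LU[of j] by simp
  moreover obtain i j where "i < j" "g (L i) \<le> g (L j)"
    using assms[unfolded well_order_poset_def, rule_format, of "\<lambda>n. g (L n)"] by blast
  ultimately show False
    by blast
qed

lemma well_order_finitely_upper_complemented:
  assumes "well_order_poset TYPE('a::order)"
  shows "finitely_upper_complemented {x :: 'a}"
proof -
  obtain F where "F \<subseteq> upper_complement {x}" "finite F" "\<forall>u\<in>upper_complement {x}. \<exists>f\<in>F. f \<le> u"
    using well_order_finite_basis[OF assms] by metis
  then show ?thesis
    unfolding finitely_upper_complemented_def finitely_upper_generated_def
    by (intro exI[of _ F]) (auto simp: upper_complement_def upper_closure_def intro: order_trans)
qed

text \<open>An element minimal among the members of a finite basis below \<open>a\<close> is minimal
  in \<open>U\<close>, because every element of \<open>U\<close> lies above a basis element.\<close>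

lemma well_order_min_elem_below:
  assumes "well_order_poset TYPE('a::order)" and "a \<in> U"
  obtains m where "m \<in> min_elems U" "m \<le> (a :: 'a)"
proof -
  obtain F where F: "F \<subseteq> U" "finite F" "\<forall>u\<in>U. \<exists>f\<in>F. f \<le> u"
    using well_order_finite_basis[OF assms(1)] by metis
  then have "finite {f \<in> F. f \<le> a}" "{f \<in> F. f \<le> a} \<noteq> {}"
    using assms(2) by auto
  then obtain m where m: "m \<in> F" "m \<le> a" "\<forall>f\<in>F. f \<le> a \<longrightarrow> f \<le> m \<longrightarrow> m = f"
    using finite_has_minimal[of "{f \<in> F. f \<le> a}"] by auto
  have "z = m" if z: "z \<in> U" "z \<le> m" for z
    by (metis F(3) m(2,3) z order_antisym order_trans)
  then have "m \<in> min_elems U"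
    using m(1) F(1) unfolding min_elems_def by blast
  then show ?thesis
    using m(2) by (rule that)
qed

section \<open>Finitely lower complemented elements and complements of intervals\<close>

lemma finitely_lower_complemented_bot: "finitely_lower_complemented {bot :: 'a::order_bot}"
  unfolding finitely_lower_complemented_def finitely_lower_generated_def
  by (rule exI[of _ "{}"]) (auto simp: lower_complement_def lower_closure_def)

lemma finitely_lower_complemented_sup:
  fixes a b :: "'a::lattice"
  assumes "finitely_lower_complemented {a}" "finitely_lower_complemented {b}"
  shows "finitely_lower_complemented {sup_class.sup a b}"
proof -
  obtain F G where F: "finite F" "lower_complement {a} = lower_closure F"
    and G: "finite G" "lower_complement {b} = lower_closure G"
    using assms unfolding finitely_lower_complemented_def finitely_lower_generated_def by blast
  have "lower_complement {sup_class.sup a b} = lower_complement {a} \<union> lower_complement {b}"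
    by (auto simp: lower_complement_def)
  also have "\<dots> = lower_closure (F \<union> G)"
    unfolding F G by (auto simp: lower_closure_def)
  finally show ?thesis
    unfolding finitely_lower_complemented_def finitely_lower_generated_def using F G by blast
qed

text \<open>For \<open>a \<le> b\<close>, an interval \<open>{x..y}\<close> misses
  \<open>{a..b}\<close> only if \<open>a\<close> is not below \<open>y\<close> or \<open>x\<close>
  is not below \<open>b\<close>, as otherwise the join of \<open>x\<close> and \<open>a\<close> is
  in both. Generators of the two complements then give the absorbing intervals.\<close>

lemma interval_compact_Compl_interval:
  fixes a b :: "'a::bounded_lattice"
  assumes "finitely_lower_complemented {a}" "finitely_upper_complemented {b}"
  shows "interval_compact (- {a..b})"
proof (cases "a \<le> b")
  case True
  obtain F where F: "finite F" "lower_complement {a} = lower_closure F"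
    using assms(1) unfolding finitely_lower_complemented_def finitely_lower_generated_def by blast
  obtain G where G: "finite G" "upper_complement {b} = upper_closure G"
    using assms(2) unfolding finitely_upper_complemented_def finitely_upper_generated_def by blast
  have F': "\<not> a \<le> x \<longleftrightarrow> (\<exists>f\<in>F. x \<le> f)" for x
    using F(2) by (auto simp: lower_complement_def lower_closure_def set_eq_iff)
  have G': "\<not> x \<le> b \<longleftrightarrow> (\<exists>g\<in>G. g \<le> x)" for x
    using G(2) by (auto simp: upper_complement_def upper_closure_def set_eq_iff)
  let ?R = "(\<lambda>f. (bot, f)) ` F \<union> (\<lambda>g. (g, top_class.top)) ` G"
  show ?thesis
  proof (rule interval_compactI[of ?R])
    show "finite ?R"
      using F(1) G(1) by simp
    show "{c..d} \<subseteq> - {a..b}" if cd: "(c, d) \<in> ?R" for c d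
    proof -
      have "\<not> a \<le> d \<or> \<not> c \<le> b"
        using cd F' G' by auto
      then show ?thesis
        by (auto intro: order_trans)
    qed
    fix x y
    assume xy: "x \<le> y" "{x..y} \<subseteq> - {a..b}"
    have "\<not> (x \<le> b \<and> a \<le> y)"
    proof
      assume "x \<le> b \<and> a \<le> y"
      then have "sup_class.sup x a \<in> {x..y} \<inter> {a..b}"
        using xy True by auto
      then show False
        using xy by blast
    qed
    then consider f where "f \<in> F" "y \<le> f" | g where "g \<in> G" "g \<le> x"
      using F' G' by blast
    then show "\<exists>(c, d)\<in>?R. c \<le> x \<and> y \<le> d"
      by cases (auto simp: bex_Un)
  qed
next
  case False
  then show ?thesis
    by (simp add: interval_compact_UNIV)
qed

text \<open>For each \<open>d\<close>, a minimal element not below \<open>d\<close> can be found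
  below \<open>a\<close>; finite complementation makes it finitely lower complemented, and
  \<open>a'\<close> is the join of these elements.\<close>

lemma finitely_lower_complemented_separates:
  fixes a :: "'a::bounded_lattice"
  assumes wo: "well_order_poset TYPE('a)" and fc: "finitely_complemented TYPE('a)"
    and "finite D" "\<And>d. d \<in> D \<Longrightarrow> \<not> a \<le> d"
  shows "\<exists>a'. finitely_lower_complemented {a'} \<and> a' \<le> a \<and> (\<forall>d\<in>D. \<not> a' \<le> d)"
  using assms(3,4)
proof (induction)
  case empty
  then show ?case
    using finitely_lower_complemented_bot by (intro exI[of _ bot]) auto
next
  case (insert d D)
  then obtain a' where a': "finitely_lower_complemented {a'}" "a' \<le> a" "\<forall>d\<in>D. \<not> a' \<le> d"
    by auto
  have "a \<in> upper_complement {d}"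
    using insert.prems by (auto simp: upper_complement_def)
  then obtain m where m: "m \<in> min_elems (upper_complement {d})" "m \<le> a"
    using well_order_min_elem_below[OF wo] by metis
  then have "finitely_lower_complemented {m}"
    using fc well_order_finitely_upper_complemented[OF wo] by (auto simp: finitely_complemented_def)
  moreover have "\<not> m \<le> d"
    using m by (auto simp: min_elems_def upper_complement_def)
  ultimately show ?case
    using a' m finitely_lower_complemented_sup by (intro exI[of _ "sup_class.sup a' m"]) auto
qed

text \<open>The lower ends of the intervals absorbing those of \<open>Y\<close> are lowered; the
  finitely many intervals covering \<open>- Y\<close> tell how far this may go.\<close>

lemma NS_finite_union_intervals:
  fixes Y :: "'a::bounded_lattice set"
  assumes wo: "well_order_poset TYPE('a)" and fc: "finitely_complemented TYPE('a)"
    and "Y \<in> NS"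
  obtains R where "finite R" "Y = (\<Union>(a, b)\<in>R. {a..b})"
    "\<And>a b. (a, b) \<in> R \<Longrightarrow> finitely_lower_complemented {a}"
proof -
  have Y: "interval_compact Y" "interval_compact (- Y)"
    using \<open>Y \<in> NS\<close> by (simp_all add: NS_iff)
  obtain R where R: "finite R" "\<forall>a b. (a, b) \<in> R \<longrightarrow> {a..b} \<subseteq> Y"
    "\<forall>x y. x \<le> y \<longrightarrow> {x..y} \<subseteq> Y \<longrightarrow> (\<exists>a b. (a, b) \<in> R \<and> a \<le> x \<and> y \<le> b)"
    using Y(1) by (rule interval_compactE)
  note R = R[rule_format]
  obtain C where C: "finite C" "\<forall>a b. (a, b) \<in> C \<longrightarrow> {a..b} \<subseteq> - Y"
    "\<forall>x y. x \<le> y \<longrightarrow> {x..y} \<subseteq> - Y \<longrightarrow> (\<exists>a b. (a, b) \<in> C \<and> a \<le> x \<and> y \<le> b)"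
    using Y(2) by (rule interval_compactE)
  note C = C[rule_format]
  have ext: "\<exists>a'. finitely_lower_complemented {a'} \<and> a' \<le> a \<and> {a'..b} \<subseteq> Y"
    if ab: "(a, b) \<in> R" "a \<le> b" for a b
  proof -
    \<comment> \<open>Choosing \<open>a'\<close> below none of these makes \<open>a'\<close> and
      \<open>a\<close> lie below the same upper ends of \<open>C\<close>.\<close>
    let ?D = "{d \<in> snd ` C. \<not> a \<le> d}"
    have "finite ?D" "\<And>d. d \<in> ?D \<Longrightarrow> \<not> a \<le> d"
      using C(1) by simp_all
    then obtain a' where a': "finitely_lower_complemented {a'}" "a' \<le> a" "\<forall>d\<in>?D. \<not> a' \<le> d"
      using finitely_lower_complemented_separates[OF wo fc] by meson
    have "z \<in> Y" if z: "a' \<le> z" "z \<le> b" for z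
    proof (rule ccontr)
      assume "z \<notin> Y"
      then obtain c d where cd: "(c, d) \<in> C" "c \<le> z" "z \<le> d"
        using C(3)[OF order_refl, of z] by auto
      have "a' \<le> d"
        using z cd by order
      then have "a \<le> d"
        using a'(3) cd(1) by force
      \<comment> \<open>A common point of an interval inside \<open>Y\<close> and one inside
        \<open>- Y\<close>.\<close>
      then have "sup_class.sup a c \<in> {a..b}" "sup_class.sup a c \<in> {c..d}"
        using cd z ab by (auto intro: order_trans)
      then show False
        using R(2)[OF ab(1)] C(2)[OF cd(1)] by blast
    qed
    then have "{a'..b} \<subseteq> Y"
      by auto
    then show ?thesis
      using a'(1,2) by blast
  qed
  define f where "f = (\<lambda>(a, b). SOME a'. finitely_lower_complemented {a'} \<and> a' \<le> a \<and> {a'..b} \<subseteq> Y)"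
  have f: "finitely_lower_complemented {f (a, b)} \<and> f (a, b) \<le> a \<and> {f (a, b)..b} \<subseteq> Y"
    if "(a, b) \<in> R" "a \<le> b" for a b
    unfolding f_def prod.case using ext[OF that] by (rule someI_ex)
  \<comment> \<open>Pairs denoting the empty set are dropped, as the choice made by \<open>f\<close>
    is justified only for \<open>a \<le> b\<close>.\<close>
  let ?R = "(\<lambda>i. (f i, snd i)) ` {(a, b) \<in> R. a \<le> b}"
  show ?thesis
  proof (rule that[of ?R])
    show "finite ?R"
      using R(1) by (auto intro: finite_subset[of _ R])
    show "finitely_lower_complemented {a}" if "(a, b) \<in> ?R" for a b
      using that f by auto
    show "Y = (\<Union>(a, b)\<in>?R. {a..b})"
    proof (intro equalityI subsetI)
      fix y assume "y \<in> (\<Union>(a, b)\<in>?R. {a..b})"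
      then obtain a b where "(a, b) \<in> R" "a \<le> b" "y \<in> {f (a, b)..b}"
        by auto
      then show "y \<in> Y"
        using f by blast
    next
      fix y assume "y \<in> Y"
      then obtain a b where ab: "(a, b) \<in> R" "a \<le> y" "y \<le> b"
        using R(3)[of y y] by auto
      then have "a \<le> b"
        by order
      then have "(f (a, b), b) \<in> ?R" and "f (a, b) \<le> a"
        using f[of a b] ab by force+
      then have "(f (a, b), b) \<in> ?R" and "y \<in> {f (a, b)..b}"
        using ab by auto
      then show "y \<in> (\<Union>(a, b)\<in>?R. {a..b})"
        by blast
    qed
  qed
qed

section \<open>Boolean algebras of sets\<close>

lemma inclusion_poset_partial_order: "partial_order (inclusion_poset F)"
  by unfold_locales (auto simp: inclusion_poset_def)

text \<open>For a field of sets, the abstract lattice operations coincide with the set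
  operations.\<close>

lemma boolean_algebra_order_inclusion_poset:
  assumes Int: "\<And>A B. A \<in> F \<Longrightarrow> B \<in> F \<Longrightarrow> A \<inter> B \<in> F"
    and Compl: "\<And>A. A \<in> F \<Longrightarrow> - A \<in> F" and UNIV: "UNIV \<in> F"
  shows "boolean_algebra_order (inclusion_poset F)"
proof -
  let ?L = "inclusion_poset F"
  interpret partial_order ?L
    by (rule inclusion_poset_partial_order)
  have Un: "A \<union> B \<in> F" if "A \<in> F" "B \<in> F" for A B
    using Compl[OF Int[OF Compl Compl], OF that] by simp
  have empty: "{} \<in> F"
    using Compl[OF UNIV] by simp
  have carrier: "carrier ?L = F"
    by (simp add: inclusion_poset_def)
  have lub: "least ?L (A \<union> B) (Upper ?L {A, B})" if "A \<in> F" "B \<in> F" for A B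
    using Un that by (auto simp: least_def Upper_def inclusion_poset_def)
  have glb: "greatest ?L (A \<inter> B) (Lower ?L {A, B})" if "A \<in> F" "B \<in> F" for A B
    using Int that by (auto simp: greatest_def Lower_def inclusion_poset_def)
  have bot: "least ?L {} (carrier ?L)" and top: "greatest ?L UNIV (carrier ?L)"
    using empty UNIV by (auto simp: least_def greatest_def inclusion_poset_def)
  interpret bounded_lattice ?L
  proof unfold_locales
    show "\<exists>s. least ?L s (Upper ?L {x, y})" "\<exists>s. greatest ?L s (Lower ?L {x, y})"
      if "x \<in> carrier ?L" "y \<in> carrier ?L" for x y
      using that lub glb unfolding carrier by blast+
  qed (use bot top in blast)+
  \<comment> \<open>Joins and meets are Hilbert choices, so they are identified by uniqueness of
    suprema and infima.\<close>
  have join: "A \<squnion>\<^bsub>?L\<^esub> B = A \<union> B" if "A \<in> F" "B \<in> F" for A B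
    unfolding join_def sup_def using lub[OF that] least_unique by (metis someI)
  have meet: "A \<sqinter>\<^bsub>?L\<^esub> B = A \<inter> B" if "A \<in> F" "B \<in> F" for A B
    unfolding meet_def inf_def using glb[OF that] greatest_unique by (metis someI)
  have ends: "\<bottom>\<^bsub>?L\<^esub> = {}" "\<top>\<^bsub>?L\<^esub> = UNIV"
    using bot top bottom_least top_greatest least_unique greatest_unique by blast+
  then show ?thesis
    unfolding boolean_algebra_order_def carrier
  proof (intro conjI ballI)
    show "\<exists>B\<in>F. A \<sqinter>\<^bsub>?L\<^esub> B = \<bottom>\<^bsub>?L\<^esub> \<and> A \<squnion>\<^bsub>?L\<^esub> B = \<top>\<^bsub>?L\<^esub>" if "A \<in> F" for A
      using that Compl[OF that] ends by (intro bexI[of _ "- A"]) (simp_all add: join meet)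
  qed (use bounded_lattice_axioms in \<open>auto simp: join meet Int Un\<close>)
qed

section \<open>Boolean structure of NS\<close>

lemma boolean_if_finitely_complemented:
  assumes wo: "well_order_poset TYPE('a::bounded_lattice)" and fc: "finitely_complemented TYPE('a)"
  shows "boolean_algebra_order (inclusion_poset (NS :: 'a set set))"
proof (rule boolean_algebra_order_inclusion_poset)
  fix Y Z :: "'a set"
  assume YZ: "Y \<in> NS" "Z \<in> NS"
  obtain R where R: "finite R" "Y = (\<Union>(a, b)\<in>R. {a..b})"
    "\<And>a b. (a, b) \<in> R \<Longrightarrow> finitely_lower_complemented {a}"
    using NS_finite_union_intervals[OF wo fc YZ(1)] by metis
  obtain S where S: "finite S" "Z = (\<Union>(a, b)\<in>S. {a..b})"
    "\<And>a b. (a, b) \<in> S \<Longrightarrow> finitely_lower_complemented {a}"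
    using NS_finite_union_intervals[OF wo fc YZ(2)] by metis
  \<comment> \<open>\<open>Y \<inter> Z\<close> is a finite union of intervals whose lower ends,
    being joins, are still finitely lower complemented; its complement is a finite intersection of
    interval-compact sets.\<close>
  let ?I = "\<lambda>((a, b), (c, d)). - {sup_class.sup a c..inf_class.inf b d}"
  have "x \<in> Y \<inter> Z \<longleftrightarrow> (\<exists>i\<in>R \<times> S. x \<notin> ?I i)" for x
    unfolding R(2) S(2) by (simp add: split_beta bex_Un) blast
  then have "- (Y \<inter> Z) = (\<Inter>i\<in>R \<times> S. ?I i)"
    by blast
  moreover have "interval_compact (\<Inter>i\<in>R \<times> S. ?I i)"
    using R S well_order_finitely_upper_complemented[OF wo]
    by (intro interval_compact_INT)
      (auto intro!: interval_compact_Compl_interval finitely_lower_complemented_sup)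
  ultimately show "Y \<inter> Z \<in> NS"
    using YZ by (auto simp: NS_iff interval_compact_Int)
qed (auto simp: NS_iff interval_compact_UNIV interval_compact_empty)

section \<open>From the boolean algebra to finite complementation\<close>

lemma atMost_in_NS:
  assumes "well_order_poset TYPE('a::bounded_lattice)"
  shows "{..x :: 'a} \<in> NS"
proof -
  have eq: "{..x} = {bot..x}"
    by auto
  have "interval_compact {bot..x}"
    by (rule interval_compactI[of "{(bot, x)}"]) auto
  moreover have "interval_compact (- {bot..x})"
    using assms finitely_lower_complemented_bot well_order_finitely_upper_complemented
    by (intro interval_compact_Compl_interval) auto
  ultimately show ?thesis
    unfolding eq NS_iff by simp
qed

text \<open>The lattice operations of \<open>NS\<close> are not known to be the set operations here,
  so only bounds are used: the meet \<open>?M\<close> lies inside \<open>{m}\<close>, and if it were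
  empty, distributing \<open>{..m}\<close> over \<open>{..x}\<close> and its complement would put
  \<open>m\<close> below \<open>x\<close>.\<close>

lemma min_elem_singleton_in_NS:
  fixes m x :: "'a::bounded_lattice"
  assumes wo: "well_order_poset TYPE('a)"
    and B: "boolean_algebra_order (inclusion_poset (NS :: 'a set set))"
    and m: "m \<in> min_elems (upper_complement {x})"
  shows "{m} \<in> NS"
proof -
  let ?L = "inclusion_poset (NS :: 'a set set)"
  interpret bounded_lattice ?L
    using B by (simp add: boolean_algebra_order_def)
  have carrier: "carrier ?L = NS" and le: "Y \<sqsubseteq>\<^bsub>?L\<^esub> Z \<longleftrightarrow> Y \<subseteq> Z" for Y Z
    by (auto simp: inclusion_poset_def)
  let ?M = "{..m} \<sqinter>\<^bsub>?L\<^esub> (- {..x})"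
  have in_NS: "{..m} \<in> NS" "{..x} \<in> NS" "- {..x} \<in> NS" "(UNIV :: 'a set) \<in> NS"
    using atMost_in_NS[OF wo] interval_compact_UNIV interval_compact_empty
    by (auto simp: NS_iff)
  have M: "?M \<in> NS" "?M \<subseteq> {..m}" "?M \<subseteq> - {..x}"
    using meet_closed meet_left meet_right in_NS unfolding carrier le by auto
  have "{..m} - {..x} \<subseteq> {m}" and mx: "\<not> m \<le> x"
    using m by (auto simp: min_elems_def upper_complement_def)
  then have Mm: "?M \<subseteq> {m}"
    using M by blast
  have "?M \<noteq> {}"
  proof
    assume empty: "?M = {}"
    have join: "{..x} \<squnion>\<^bsub>?L\<^esub> (- {..x}) = UNIV"
      using join_left[of "{..x}" "- {..x}"] join_right[of "{..x}" "- {..x}"] in_NS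
      unfolding carrier le by blast
    let ?K = "{..m} \<sqinter>\<^bsub>?L\<^esub> {..x}"
    have K: "?K \<in> NS" "?K \<subseteq> {..x}"
      using meet_closed meet_right in_NS unfolding carrier le by auto
    have "{..m} \<subseteq> {..m} \<sqinter>\<^bsub>?L\<^esub> UNIV"
      using meet_le[of "{..m}" "{..m}" UNIV] in_NS unfolding carrier le by auto
    also have "\<dots> = ?K \<squnion>\<^bsub>?L\<^esub> ?M"
      using B in_NS unfolding boolean_algebra_order_def carrier join[symmetric] by blast
    also have "\<dots> \<subseteq> {..x}"
      using join_le[of ?K "{..x}" ?M] K M(1) in_NS empty unfolding carrier le by auto
    finally show False
      using mx by auto
  qed
  then have "?M = {m}"
    using Mm by blast
  then show ?thesis
    using M(1) by simp
qed

text \<open>If \<open>m\<close> is not below \<open>y\<close>, then \<open>{bot..y}\<close> avoids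
  \<open>m\<close>; upper ends of the absorbing intervals generate the lower complement.\<close>

lemma finitely_lower_complemented_if_interval_compact:
  fixes m :: "'a::bounded_lattice"
  assumes "interval_compact (- {m})"
  shows "finitely_lower_complemented {m}"
proof -
  obtain R where R: "finite R" "\<forall>a b. (a, b) \<in> R \<longrightarrow> {a..b} \<subseteq> - {m}"
    "\<forall>x y. x \<le> y \<longrightarrow> {x..y} \<subseteq> - {m} \<longrightarrow> (\<exists>a b. (a, b) \<in> R \<and> a \<le> x \<and> y \<le> b)"
    using assms by (rule interval_compactE)
  note R = R[rule_format]
  let ?F = "{b \<in> snd ` R. \<not> m \<le> b}"
  have "\<exists>b\<in>?F. y \<le> b" if y: "\<not> m \<le> y" for y
  proof -
    have "{bot..y} \<subseteq> - {m}"
      using y by auto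
    then obtain a b where ab: "(a, b) \<in> R" "a \<le> bot" "y \<le> b"
      using R(3)[of bot y] by auto
    \<comment> \<open>The absorbing interval starts at \<open>bot\<close>, so avoiding
      \<open>m\<close> means that \<open>m\<close> is not below \<open>b\<close>.\<close>
    then have "\<not> m \<le> b"
      using R(2)[OF ab(1)] by (auto simp: bot_unique)
    then show ?thesis
      using ab by force
  qed
  then have "lower_complement {m} = lower_closure ?F"
    by (auto simp: lower_complement_def lower_closure_def intro: order_trans)
  then show ?thesis
    unfolding finitely_lower_complemented_def finitely_lower_generated_def
    using R(1) by (intro exI[of _ ?F]) auto
qed

theorem theorem6p5:
  assumes "well_order_poset TYPE('a::bounded_lattice)"
  shows "boolean_algebra_order (inclusion_poset (NS :: 'a set set)) \<longleftrightarrow>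
         finitely_complemented TYPE('a)"
proof
  assume "boolean_algebra_order (inclusion_poset (NS :: 'a set set))"
  then have "finitely_lower_complemented {m}" if "m \<in> min_elems (upper_complement {x})" for m x :: 'a
    using min_elem_singleton_in_NS[OF assms _ that]
    by (auto simp: NS_iff intro: finitely_lower_complemented_if_interval_compact)
  \<comment> \<open>The first condition holds since every element is finitely upper complemented;
    the second is the fact just derived.\<close>
  then show "finitely_complemented TYPE('a)"
    using well_order_finitely_upper_complemented[OF assms] by (auto simp: finitely_complemented_def)
qed (rule boolean_if_finitely_complemented[OF assms])

end
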